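(* Let $F=(f,V)$ be a symplectic root system over $\mathbb{F}_2$ of type $(n,k)$ on a graph $\mathcal{D}$, let $p\in\mathcal{D}$ be any node, and denote by $\mathcal{G}$ the induced subgraph on $\mathcal{D}-p$. Then the restricted symplectic root system $F|_{\mathcal{G}}=(f|_{\mathcal{G}},W)$ is one of the following: (1) of the same type $(n,k)$, and $F$ was not minimal; (2) of type $(n,k-1)$, and in particular $F$ was not extraspecial; (3) of type $(n-1,k+1)$, and in particular $F|_{\mathcal{G}}$ is not extraspecial.
   Context: Graphs are finite, undirected, without loops or multiple edges; vector spaces are finite-dimensional. A symplectic vector space over a field $\Bbbk$ is a $\Bbbk$-vector space $V$ with a (possibly degenerate) bilinear form $\langle,\rangle:V\times V\to\Bbbk$ such that $\langle v,v\rangle=0$ for all $v\in V$. Its nullspace is $V^\perp=\{v\in V\mid \langle v,w\rangle=0\ \forall w\in V\}$. $V$ has type $(n,k)$ if $k=\dim V^\perp$ and $2n+k=\dim V$; it is extraspecial if $V^\perp=0$, i.e. of type $(n,0)$. A symplectic root system $F=(f,V)$ over $\mathbb{F}_2$ on a graph $\mathcal{D}$ consists of a symplectic vector space $V$ over $\mathbb{F}_2$ and a map $f$ from the nodes of $\mathcal{D}$ to $V$ such that the image $f(\mathcal{D})$ generates $V$, and two nodes $\alpha,\beta$ are adjacent in $\mathcal{D}$ if and only if $\langle f(\alpha),f(\beta)\rangle\neq 0$. Its type is the type of $V$, and it is called extraspecial if $V$ is. It is minimal if the family $\{f(\alpha)\}_{\alpha\in\mathcal{D}}$ is a basis of $V$.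 For an induced subgraph $\mathcal{G}\subset\mathcal{D}$, the restriction $F|_{\mathcal{G}}$ is $(f|_{\mathcal{G}},W)$, with $W\subset V$ the subspace generated by $f(\mathcal{G})$, with the restricted form. *)

theory Defs
  imports "HOL-Library.Z2" "Graph_Theory.Digraph" "Graph_Theory.Digraph_Component"
begin

text \<open>
  A symplectic vector space is given by a subspace \<open>V\<close> of an ambient vector space together with a
  form of which only the values on \<open>V\<close> are relevant. Hence a subspace \<open>W\<close> of \<open>V\<close> with the
  restricted form is simply \<open>W\<close> with the same \<open>form\<close>. The form may be degenerate.
\<close>

locale symplectic_space = vector_space scale
  for scale :: "'k::field \<Rightarrow> 'v::ab_group_add \<Rightarrow> 'v" (infixr \<open>*s\<close> 75) +
  fixes V :: "'v set" and form :: "'v \<Rightarrow> 'v \<Rightarrow> 'k"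
  assumes subspace_V: "subspace V"
    and finite_dim_V: "\<exists>B. finite B \<and> span B = V"
    and form_add_left: "\<lbrakk>u \<in> V; v \<in> V; w \<in> V\<rbrakk> \<Longrightarrow> form (u + v) w = form u w + form v w"
    and form_add_right: "\<lbrakk>u \<in> V; v \<in> V; w \<in> V\<rbrakk> \<Longrightarrow> form u (v + w) = form u v + form u w"
    and form_scale_left: "\<lbrakk>v \<in> V; w \<in> V\<rbrakk> \<Longrightarrow> form (c *s v) w = c * form v w"
    and form_scale_right: "\<lbrakk>v \<in> V; w \<in> V\<rbrakk> \<Longrightarrow> form v (c *s w) = c * form v w"
    and form_self: "v \<in> V \<Longrightarrow> form v v = 0"

definition nullspace :: "'v set \<Rightarrow> ('v \<Rightarrow> 'v \<Rightarrow> 'k::zero) \<Rightarrow> 'v set" where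
  "nullspace V form = {v \<in> V. \<forall>w\<in>V. form v w = 0}"

definition extraspecial :: "'v::zero set \<Rightarrow> ('v \<Rightarrow> 'v \<Rightarrow> 'k::zero) \<Rightarrow> bool" where
  "extraspecial V form \<longleftrightarrow> nullspace V form = {0}"

definition (in vector_space) has_symplectic_type ::
    "'b set \<Rightarrow> ('b \<Rightarrow> 'b \<Rightarrow> 'a) \<Rightarrow> nat \<Rightarrow> nat \<Rightarrow> bool" where
  "has_symplectic_type V form n k \<longleftrightarrow> k = dim (nullspace V form) \<and> 2 * n + k = dim V"

text \<open>
  The locale \<open>graph\<close> describes finite simple undirected graphs, an edge being a pair of opposite
  arcs. Only the values of \<open>f\<close> on the nodes are relevant, so that the same \<open>f\<close> also serves as its
  restriction to the nodes of a subgraph.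
\<close>

locale symplectic_root_system =
  symplectic_space scale V form + graph D
  for scale :: "bit \<Rightarrow> 'v::ab_group_add \<Rightarrow> 'v" (infixr \<open>*s\<close> 75)
    and V :: "'v set" and form :: "'v \<Rightarrow> 'v \<Rightarrow> bit"
    and D :: "('a, 'e) pre_digraph" +
  fixes f :: "'a \<Rightarrow> 'v"
  assumes f_in_V: "\<alpha> \<in> verts D \<Longrightarrow> f \<alpha> \<in> V"
    and span_f: "span (f ` verts D) = V"
    and adjacent_iff: "\<lbrakk>\<alpha> \<in> verts D; \<beta> \<in> verts D\<rbrakk> \<Longrightarrow> \<alpha> \<rightarrow>\<^bsub>D\<^esub> \<beta> \<longleftrightarrow> form (f \<alpha>) (f \<beta>) \<noteq> 0"

text \<open>The condition \<open>inj_on\<close> is needed since minimality refers to the family, not to its image.\<close>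

definition (in vector_space) minimal_root_system ::
    "'b set \<Rightarrow> ('n, 'e) pre_digraph \<Rightarrow> ('n \<Rightarrow> 'b) \<Rightarrow> bool" where
  "minimal_root_system V D f \<longleftrightarrow>
     inj_on f (verts D) \<and> independent (f ` verts D) \<and> span (f ` verts D) = V"

end

theory Submission
  imports Defs
begin

text \<open>
  If \<open>f p\<close> lies in \<open>W\<close>, then \<open>W = V\<close> and the family was not a basis. Otherwise \<open>W\<close> is a hyperplane
  of \<open>V\<close>. If the nullspace of \<open>V\<close> is not contained in \<open>W\<close>, it meets \<open>W\<close> exactly in the nullspace
  of \<open>W\<close>, whose dimension is thus one less. If it is contained in \<open>W\<close>, the nullspace of
  \<open>W\<close> contains it, as the kernel of the functional given by \<open>f p\<close>, so the dimension stays the same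
  or grows by one; the former is impossible since the rank of an alternating form is even.
\<close>

section \<open>Bases and hyperplanes inside a finitely spanned set\<close>

context vector_space
begin

lemma subspace_finite_span:
  assumes "subspace W" "W \<subseteq> span B" "finite B"
  shows "\<exists>C. finite C \<and> span C = W"
proof -
  obtain C where "C \<subseteq> W" "independent C" "W \<subseteq> span C"
    using maximal_independent_subset by blast
  then show ?thesis
    using assms independent_span_bound[of B C] span_subspace[of C W] by blast
qed

text \<open>A basis of \<open>S\<close> extended by \<open>x\<close> is a basis of \<open>T\<close>.
  The ambient space may have infinite dimension, so finiteness of the basis comes from the finite
  set \<open>B\<close> whose span contains \<open>T\<close>.\<close>

lemma dim_eq_Suc_dim_hyperplane:
  assumes "subspace S" "S \<subseteq> T" "T \<subseteq> span B" "finite B"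
    and x: "x \<in> T" "x \<notin> S" and T: "\<And>y. y \<in> T \<Longrightarrow> \<exists>c. y - scale c x \<in> S"
  shows "dim T = Suc (dim S)"
proof -
  obtain C where C: "C \<subseteq> S" "independent C" "S \<subseteq> span C" "card C = dim S"
    using basis_exists by blast
  have "span C = S"
    using C assms(1) by (simp add: span_subspace)
  moreover have "finite C"
    using independent_span_bound[of B C] C assms by blast
  moreover have "x \<notin> C"
    using C x by blast
  ultimately show ?thesis
    using C x T assms(2)
    by (intro dim_unique[of "insert x C"])
      (auto simp: independent_insert span_breakdown_eq)
qed

end

section \<open>Elementary properties of alternating forms and their nullspaces\<close>

context symplectic_space
begin

lemma symplectic_space_subspace:
  assumes "subspace W" "W \<subseteq> V"
  shows "symplectic_space scale W form"
proof -
  have "\<exists>B. finite B \<and> span B = W"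
    using finite_dim_V assms subspace_finite_span by blast
  with assms show ?thesis
    by unfold_locales
      (auto intro: form_add_left form_add_right form_scale_left form_scale_right form_self)
qed

lemma dim_eq_Suc_dim_hyperplane_V:
  assumes "subspace S" "S \<subseteq> T" "T \<subseteq> V" "x \<in> T" "x \<notin> S"
    and "\<And>y. y \<in> T \<Longrightarrow> \<exists>c. y - c *s x \<in> S"
  shows "dim T = Suc (dim S)"
  using finite_dim_V assms dim_eq_Suc_dim_hyperplane[of S T] by blast

lemma form_diff_scale_left:
  assumes "u \<in> V" "v \<in> V" "w \<in> V"
  shows "form (u - c *s v) w = form u w - c * form v w"
proof -
  have "form (u - c *s v) w = form (u + (- c) *s v) w"
    by simp
  also have "\<dots> = form u w + form ((- c) *s v) w"
    by (rule form_add_left) (use assms subspace_V subspace_scale in blast)+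
  also have "\<dots> = form u w - c * form v w"
    using form_scale_left[OF assms(2,3), of "- c"] by simp
  finally show ?thesis .
qed

text \<open>Polarization: expand \<open>form (u + v) (u + v) = 0\<close>, where the two diagonal
  terms vanish.\<close>

lemma form_swap:
  assumes "u \<in> V" "v \<in> V"
  shows "form u v = - form v u"
proof -
  have uv: "u + v \<in> V"
    using assms subspace_V by (simp add: subspace_add)
  then have "0 = form u (u + v) + form v (u + v)"
    using assms form_add_left form_self by metis
  also have "\<dots> = form u v + form v u"
    using assms by (simp add: form_add_right form_self)
  finally show ?thesis
    by (metis eq_neg_iff_add_eq_0)
qed

lemma form_zero_left: "w \<in> V \<Longrightarrow> form 0 w = 0"
  using form_scale_left[of 0 w 0] subspace_V subspace_0 by simp

lemma subspace_nullspace: "subspace (nullspace V form)"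
  using subspace_V
  by (auto simp: subspace_def nullspace_def form_zero_left form_add_left form_scale_left)

lemma subspace_orthogonal:
  assumes "v \<in> V"
  shows "subspace {x \<in> V. form x v = 0}"
  using assms subspace_V
  by (auto simp: subspace_def form_zero_left form_add_left form_scale_left)

lemma diff_scale_mem: "\<lbrakk>u \<in> V; v \<in> V\<rbrakk> \<Longrightarrow> u - c *s v \<in> V"
  using subspace_V by (intro subspace_diff subspace_scale)

text \<open>The fourth assumption expresses that \<open>W\<close> and \<open>v\<close> together
  generate \<open>V\<close>, so being orthogonal to \<open>W\<close> and to \<open>v\<close>
  suffices. The same formulation serves in all the hyperplane arguments.\<close>

lemma nullspace_memI:
  assumes "x \<in> V" "W \<subseteq> V" "v \<in> V"
    and "\<And>y. y \<in> V \<Longrightarrow> \<exists>c. y - c *s v \<in> W"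
    and "\<And>w. w \<in> W \<Longrightarrow> form x w = 0" "form x v = 0"
  shows "x \<in> nullspace V form"
proof -
  have "form x y = 0" if y: "y \<in> V" for y
  proof -
    obtain c where c: "y - c *s v \<in> W"
      using assms(4)[OF y] by blast
    then have "form (y - c *s v) x = 0"
      using form_swap[OF subsetD[OF assms(2) c] assms(1)] assms(5)[OF c] by simp
    moreover have "form v x = 0"
      using form_swap[OF assms(3,1)] assms(6) by simp
    ultimately have "form y x = 0"
      using form_diff_scale_left[OF y assms(3,1), of c] by simp
    then show ?thesis
      using form_swap[OF assms(1) y] by simp
  qed
  then show ?thesis
    using assms(1) by (simp add: nullspace_def)
qed

section \<open>The nullspace of a hyperplane\<close>

text \<open>The vector \<open>z\<close> can replace \<open>v\<close> as a complement of
  \<open>W\<close>. Being orthogonal to everything, it imposes no condition on vectors of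
  \<open>nullspace W form\<close>, so these lie in \<open>nullspace V form\<close>, and
  \<open>z\<close> generates the rest.\<close>

lemma dim_nullspace_hyperplane_not_subset:
  assumes W: "subspace W" "W \<subseteq> V"
    and v: "v \<in> V" "v \<notin> W" "\<And>y. y \<in> V \<Longrightarrow> \<exists>c. y - c *s v \<in> W"
    and z: "z \<in> nullspace V form" "z \<notin> W"
  shows "dim (nullspace V form) = Suc (dim (nullspace W form))"
proof -
  interpret W: symplectic_space scale W form
    using W by (rule symplectic_space_subspace)
  have zV: "z \<in> V"
    using z(1) by (simp add: nullspace_def)
  have z_orth: "form x z = 0" if "x \<in> V" for x
    using z(1) that form_swap[OF that zV] by (simp add: nullspace_def)
  have z_gen: "\<exists>c. y - c *s z \<in> W" if y: "y \<in> V" for y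
  proof -
    obtain a where a: "z - a *s v \<in> W"
      using v(3)[OF zV] ..
    obtain b where b: "y - b *s v \<in> W"
      using v(3)[OF y] ..
    have "a \<noteq> 0"
      using a z(2) by auto
    \<comment> \<open>The coefficient \<open>b / a\<close> makes the multiples of \<open>v\<close>
      cancel: modulo \<open>W\<close>, \<open>z\<close> is \<open>a\<close> times \<open>v\<close>
      and \<open>y\<close> is \<open>b\<close> times \<open>v\<close>.\<close>
    then have "y - (b / a) *s z = (y - b *s v) - (b / a) *s (z - a *s v)"
      by (simp add: scale_right_diff_distrib)
    also have "\<dots> \<in> W"
      by (intro subspace_diff subspace_scale W(1) a b)
    finally show ?thesis ..
  qed
  have sub: "nullspace W form \<subseteq> nullspace V form"
  proof
    fix x assume x: "x \<in> nullspace W form"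
    then have "x \<in> V"
      using W(2) by (auto simp: nullspace_def)
    then show "x \<in> nullspace V form"
      by (rule nullspace_memI[OF _ W(2) zV z_gen])
        (use x z_orth \<open>x \<in> V\<close> in \<open>auto simp: nullspace_def\<close>)
  qed
  have "\<exists>c. y - c *s z \<in> nullspace W form" if y: "y \<in> nullspace V form" for y
  proof -
    obtain c where c: "y - c *s z \<in> W"
      using z_gen[of y] y by (auto simp: nullspace_def)
    have "y - c *s z \<in> nullspace V form"
      using y z(1) subspace_nullspace by (intro subspace_diff subspace_scale)
    then have "y - c *s z \<in> nullspace W form"
      using c W(2) by (auto simp: nullspace_def)
    then show ?thesis ..
  qed
  moreover have "nullspace V form \<subseteq> V" "z \<notin> nullspace W form"
    using z(2) by (auto simp: nullspace_def)
  ultimately show ?thesis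
    using z(1) sub W.subspace_nullspace
    by (intro dim_eq_Suc_dim_hyperplane_V[of _ _ z])
qed

lemma dim_nullspace_hyperplane_subset:
  assumes W: "subspace W" "W \<subseteq> V"
    and v: "v \<in> V" "\<And>y. y \<in> V \<Longrightarrow> \<exists>c. y - c *s v \<in> W"
    and N: "nullspace V form \<subseteq> W"
  shows "dim (nullspace W form) = dim (nullspace V form) \<or>
    dim (nullspace W form) = Suc (dim (nullspace V form))"
proof -
  interpret W: symplectic_space scale W form
    using W by (rule symplectic_space_subspace)
  have sub: "nullspace V form \<subseteq> nullspace W form"
    using N W by (auto simp: nullspace_def)
  have mem: "x \<in> nullspace V form" if x: "x \<in> nullspace W form" "form x v = 0" for x
  proof -
    have "x \<in> V"
      using x W(2) by (auto simp: nullspace_def)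
    then show ?thesis
      by (rule nullspace_memI[OF _ W(2) v]) (use x in \<open>auto simp: nullspace_def\<close>)
  qed
  show ?thesis
  proof (cases "nullspace W form \<subseteq> nullspace V form")
    case True
    with sub show ?thesis by auto
  next
    case False
    then obtain x where x: "x \<in> nullspace W form" "x \<notin> nullspace V form"
      by blast
    then have "form x v \<noteq> 0"
      using mem by blast
    have "\<exists>c. y - c *s x \<in> nullspace V form" if y: "y \<in> nullspace W form" for y
    proof -
      \<comment> \<open>This is the coefficient that makes \<open>y - ?c *s x\<close> orthogonal to
        \<open>v\<close>, hence an element of \<open>nullspace V form\<close> by
        \<open>mem\<close>.\<close>
      let ?c = "form y v / form x v"
      have "y - ?c *s x \<in> nullspace W form"
        using x y W.subspace_nullspace by (intro subspace_diff subspace_scale)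
      moreover have "x \<in> V" "y \<in> V"
        using x y W(2) by (auto simp: nullspace_def)
      then have "form (y - ?c *s x) v = 0"
        using v(1) \<open>form x v \<noteq> 0\<close> by (simp add: form_diff_scale_left)
      ultimately show ?thesis
        using mem by blast
    qed
    moreover have "nullspace W form \<subseteq> V"
      using W(2) by (auto simp: nullspace_def)
    ultimately show ?thesis
      using x sub subspace_nullspace
      by (intro disjI2 dim_eq_Suc_dim_hyperplane_V[of _ _ x])
  qed
qed

section \<open>Evenness of the rank\<close>

text \<open>The vectors \<open>u\<close> and \<open>v\<close> span a hyperbolic plane with
  orthogonal complement \<open>W\<close>. It is split off in two hyperplane steps: \<open>v\<close>
  complements the orthogonal space of \<open>u\<close> in \<open>V\<close>, and \<open>u\<close>,
  which is orthogonal to itself, complements \<open>W\<close> in that space.\<close>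

lemma hyperbolic_complement:
  assumes uv: "u \<in> V" "v \<in> V" "form u v \<noteq> 0"
  defines "W \<equiv> {x \<in> V. form x u = 0 \<and> form x v = 0}"
  shows "subspace W" "dim V = Suc (Suc (dim W))" "nullspace W form = nullspace V form"
proof -
  let ?U = "{x \<in> V. form x u = 0}"
  have U: "subspace ?U"
    using uv by (intro subspace_orthogonal)
  interpret U: symplectic_space scale ?U form
    using U by (rule symplectic_space_subspace) auto
  have "W = ?U \<inter> {x \<in> V. form x v = 0}"
    by (auto simp: W_def)
  then show W: "subspace W"
    using U subspace_orthogonal[OF uv(2)] by (simp add: subspace_inter)
  have vu: "form v u \<noteq> 0"
    using uv form_swap[of u v] by auto
  have U_gen: "\<exists>c. y - c *s v \<in> ?U" if "y \<in> V" for y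
    using that uv vu
    by (intro exI[of _ "form y u / form v u"]) (simp add: form_diff_scale_left diff_scale_mem)
  have W_gen: "\<exists>c. y - c *s u \<in> W" if "y \<in> ?U" for y
    using that uv form_self
    by (intro exI[of _ "form y v / form u v"])
      (simp add: W_def form_diff_scale_left diff_scale_mem)
  have "dim V = Suc (dim ?U)"
    using uv vu
    by (intro dim_eq_Suc_dim_hyperplane_V[OF U _ _ _ _ U_gen]) auto
  moreover have "dim ?U = Suc (dim W)"
    using uv form_self
    by (intro dim_eq_Suc_dim_hyperplane_V[OF W _ _ _ _ W_gen]) (auto simp: W_def)
  ultimately show "dim V = Suc (Suc (dim W))"
    by simp
  show "nullspace W form = nullspace V form"
  proof
    show "nullspace V form \<subseteq> nullspace W form"
      using uv by (auto simp: nullspace_def W_def)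
  next
    show "nullspace W form \<subseteq> nullspace V form"
    proof
      fix x assume x: "x \<in> nullspace W form"
      then have x_mem: "x \<in> V" "form x u = 0" "form x v = 0"
        by (auto simp: nullspace_def W_def)
      \<comment> \<open>Orthogonality of \<open>x\<close> spreads from \<open>W\<close> to
        \<open>?U\<close> by adding \<open>u\<close>, and then from \<open>?U\<close> to
        \<open>V\<close> by adding \<open>v\<close>.\<close>
      have "x \<in> nullspace ?U form"
        by (rule U.nullspace_memI[OF _ _ _ W_gen])
          (use x x_mem uv form_self in \<open>auto simp: nullspace_def W_def\<close>)
      then show "x \<in> nullspace V form"
        by (intro nullspace_memI[OF x_mem(1) _ uv(2) U_gen])
          (use x_mem in \<open>auto simp: nullspace_def\<close>)
    qed
  qed
qed

end

text \<open>Splitting off a hyperbolic plane lowers the dimension by two and keeps the nullspace;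
  when no plane is left, the form is zero and the nullspace is the whole space.\<close>

lemma (in vector_space) dim_eq_double_add_dim_nullspace:
  assumes "symplectic_space scale V form"
  shows "\<exists>n. dim V = 2 * n + dim (nullspace V form)"
  using assms
proof (induction "dim V" arbitrary: V rule: less_induct)
  case less
  interpret symplectic_space scale V form
    by (rule less.prems)
  show ?case
  proof (cases "\<exists>u\<in>V. \<exists>v\<in>V. form u v \<noteq> 0")
    case False
    then have "nullspace V form = V"
      by (auto simp: nullspace_def)
    then show ?thesis
      by (intro exI[of _ 0]) simp
  next
    case True
    then obtain u v where uv: "u \<in> V" "v \<in> V" "form u v \<noteq> 0"
      by blast
    let ?W = "{x \<in> V. form x u = 0 \<and> form x v = 0}"
    note W = hyperbolic_complement[OF uv]
    have "symplectic_space scale ?W form"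
      using W(1) by (rule symplectic_space_subspace) auto
    then obtain n where "dim ?W = 2 * n + dim (nullspace ?W form)"
      using less.hyps[of ?W] W(2) by auto
    with W show ?thesis
      by (intro exI[of _ "Suc n"]) simp
  qed
qed

section \<open>Restriction of a root system to an induced subgraph\<close>

lemma (in graph) graph_induced_subgraph:
  assumes "induced_subgraph H G"
  shows "graph H"
proof -
  interpret H: digraph H
    using assms by (rule digraphI_induced)
  show ?thesis
    by (rule H.graphI[OF induced_graph_imp_symmetric[OF sym_arcs assms]])
qed

lemma (in symplectic_root_system) symplectic_root_system_induce_subgraph:
  assumes "S \<subseteq> verts D"
  shows "symplectic_root_system scale (span (f ` S)) form (D \<restriction> S) f"
proof -
  have "span (f ` S) \<subseteq> V"
    using span_mono[OF image_mono[OF assms], of f] span_f by simp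
  then interpret W: symplectic_space scale "span (f ` S)" form
    by (intro symplectic_space_subspace) auto
  interpret G: graph "D \<restriction> S"
    by (rule graph_induced_subgraph[OF induced_induce[OF assms]])
  show ?thesis
  proof
    fix \<alpha> \<beta>
    assume "\<alpha> \<in> verts (D \<restriction> S)" "\<beta> \<in> verts (D \<restriction> S)"
    then have "\<alpha> \<rightarrow>\<^bsub>D \<restriction> S\<^esub> \<beta> \<longleftrightarrow> \<alpha> \<rightarrow>\<^bsub>D\<^esub> \<beta>" "\<alpha> \<in> verts D" "\<beta> \<in> verts D"
      using assms by (auto simp: arcs_ends_conv)
    then show "\<alpha> \<rightarrow>\<^bsub>D \<restriction> S\<^esub> \<beta> \<longleftrightarrow> form (f \<alpha>) (f \<beta>) \<noteq> 0"
      by (simp add: adjacent_iff)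
  qed (auto intro: span_base)
qed

section \<open>The three cases for the removal of a node\<close>

theorem theorem4p3:
  fixes scale :: "bit \<Rightarrow> 'v::ab_group_add \<Rightarrow> 'v"
    and V :: "'v set" and form :: "'v \<Rightarrow> 'v \<Rightarrow> bit"
    and D :: "('a, 'e) pre_digraph" and f :: "'a \<Rightarrow> 'v"
    and n k :: nat and p :: 'a
  assumes "symplectic_root_system scale V form D f"
    and "vector_space.has_symplectic_type scale V form n k"
    and "p \<in> verts D"
  shows "let G = D \<restriction> (verts D - {p}); W = module.span scale (f ` verts G) in
    symplectic_root_system scale W form G f \<and>
    ((vector_space.has_symplectic_type scale W form n k \<and>
        \<not> vector_space.minimal_root_system scale V D f) \<or>
     (k \<ge> 1 \<and> vector_space.has_symplectic_type scale W form n (k - 1) \<and>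
        \<not> extraspecial V form) \<or>
     (n \<ge> 1 \<and> vector_space.has_symplectic_type scale W form (n - 1) (k + 1) \<and>
        \<not> extraspecial W form))"
proof -
  interpret symplectic_root_system scale V form D f
    by fact
  define W where "W = span (f ` (verts D - {p}))"
  have V_eq: "V = span (insert (f p) (f ` (verts D - {p})))"
    using span_f assms(3) by (metis image_insert insert_Diff)
  have W: "subspace W" "W \<subseteq> V"
    unfolding W_def V_eq by (auto intro!: subspace_span span_mono)
  have gen: "\<exists>c. y - scale c (f p) \<in> W" if "y \<in> V" for y
    using that unfolding V_eq W_def by (simp add: span_breakdown_eq)
  have root: "symplectic_root_system scale W form (D \<restriction> (verts D - {p})) f"
    unfolding W_def by (rule symplectic_root_system_induce_subgraph) auto
  interpret W: symplectic_space scale W form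
    using W by (rule symplectic_space_subspace)
  have dims: "k = dim (nullspace V form)" "2 * n + k = dim V"
    using assms(2) by (auto simp: has_symplectic_type_def)
  have not_extraspecial: "\<not> extraspecial U form" if "dim (nullspace U form) \<noteq> 0" for U
    using that dim_unique[of "{}" "{0}" 0] independent_empty by (auto simp: extraspecial_def)
  have "(has_symplectic_type W form n k \<and> \<not> minimal_root_system V D f) \<or>
     (k \<ge> 1 \<and> has_symplectic_type W form n (k - 1) \<and> \<not> extraspecial V form) \<or>
     (n \<ge> 1 \<and> has_symplectic_type W form (n - 1) (k + 1) \<and> \<not> extraspecial W form)"
  proof (cases "f p \<in> W")
    case True
    then have "W = V"
      unfolding V_eq W_def by (simp add: span_redundant)
    moreover have "\<not> minimal_root_system V D f"
    proof
      assume "minimal_root_system V D f"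
      then have inj: "inj_on f (verts D)" and ind: "independent (f ` verts D)"
        by (auto simp: minimal_root_system_def)
      \<comment> \<open>Injectivity excludes that another node has the image \<open>f p\<close>.
        Thus \<open>f p\<close> lies in the span of the other basis vectors, against
        independence.\<close>
      have "f ` (verts D - {p}) = f ` verts D - {f p}"
        using inj assms(3) by (auto simp: inj_on_def)
      then show False
        using ind True assms(3) unfolding W_def dependent_def by auto
    qed
    ultimately show ?thesis
      using assms(2) by simp
  next
    case False': False
    have dimV: "dim V = Suc (dim W)"
      using False' W(2) f_in_V[OF assms(3)]
      by (intro dim_eq_Suc_dim_hyperplane_V[OF W(1) _ _ _ _ gen]) auto
    show ?thesis
    proof (cases "nullspace V form \<subseteq> W")
      case False
      then obtain z where z: "z \<in> nullspace V form" "z \<notin> W"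
        by blast
      have "dim (nullspace V form) = Suc (dim (nullspace W form))"
        by (rule dim_nullspace_hyperplane_not_subset[OF W f_in_V[OF assms(3)] False' gen z])
      \<comment> \<open>Dimension and nullity both drop by one, so \<open>n\<close> stays the same;
        \<open>k\<close> is a successor, which gives \<open>k \<ge> 1\<close>.\<close>
      then show ?thesis
        using dims dimV not_extraspecial[of V] by (auto simp: has_symplectic_type_def)
    next
      case True
      have "dim (nullspace W form) = dim (nullspace V form) \<or>
          dim (nullspace W form) = Suc (dim (nullspace V form))"
        by (rule dim_nullspace_hyperplane_subset[OF W f_in_V[OF assms(3)] gen True])
      \<comment> \<open>Parity decides between the two values: \<open>2 * n + k\<close> is
        \<open>dim W + 1\<close>, so nullity \<open>k\<close> for \<open>W\<close> would give
        \<open>2 * n = 2 * m + 1\<close>. With nullity \<open>k + 1\<close> it follows that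
        \<open>n = m + 1\<close>.\<close>
      moreover obtain m where m: "dim W = 2 * m + dim (nullspace W form)"
        using dim_eq_double_add_dim_nullspace[OF W.symplectic_space_axioms] ..
      ultimately have "dim (nullspace W form) = k + 1" "n = Suc m"
        using dims dimV by arith+
      then show ?thesis
        using m not_extraspecial[of W] by (simp add: has_symplectic_type_def)
    qed
  qed
  with root show ?thesis
    by (simp add: Let_def W_def)
qed

end
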